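(* Let $(p_k)_{k\ge0}$ be a probability distribution on $\mathbb N=\{0,1,2,\dots\}$ with $p_0>0$ and $p_0+p_1<1$ (possibly of unbounded support), and let $n\ge1$. By convention let $p_{-1}=1$, and fix a boundary condition $X_{a(0)}\in\{1,2,\dots\}$. For $\chi=(X_i)_{i\in\Lambda_n}\in\Omega_n=(\{-1\}\cup\mathbb N)^{\Lambda_n}$ let $$\mu^{GW}(\chi)=\prod_{i\in\Lambda_n}p_{X_i}\Bigl(1_{X_{a(i)}\ge r(i)}1_{X_i\ge0}+1_{X_{a(i)}<r(i)}1_{X_i<0}\Bigr),$$ and for a tree $\omega$ sampled from a Bienaymé–Galton–Watson (BGW) chain with offspring law $(p_k)$ at time $n$ let $\mathbb P^{GW}(\omega)=\prod_{i\in\omega}p_{X_i(\omega)}$. Then there is a bijection $\chi\leftrightarrow\omega$ between the support of $\mu^{GW}$ and the set of BGW trees at time $n$, under which $\mu^{GW}$ and $\mathbb P^{GW}$ correspond to each other: $$\chi\mapsto\omega(\chi),\quad \mathbb P^{GW}(\omega(\chi))=\mu^{GW}(\chi);\qquad \omega\mapsto\chi(\omega),\quad \mu^{GW}(\chi(\omega))=\mathbb P^{GW}(\omega).$$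
   Context: Sites: $\Lambda_n=\bigcup_{n'=0}^n\{1,2,\dots\}^{n'}$, with $\{1,2,\dots\}^0=\{0\}$ (the root, denoted $0$), is the set of all possible Neveu labels $i=i_1i_2\dots i_{n'}$, $n'\le n$. The parent $a(i)$ of $i=i_1\dots i_{n'}$ is $i_1\dots i_{n'-1}$ (the root if $n'=1$), and the rank $r(i)$ of $i$ is its last digit $i_{n'}$; for the root, $r(0)=1$ and $a(0)$ is a virtual ancestor carrying the fixed value $X_{a(0)}$. Trees: a planar rooted tree $\omega$ at time $n$ has nodes $i\in\omega\subset\Lambda_n$ (distance to the root $\le n$), each with a number of offspring $X_i(\omega)\in\mathbb N$, the children of a node $i$ at distance less than $n$ being the sites with parent $i$ and rank $1,\dots,X_i(\omega)$; the offspring of nodes at distance exactly $n$ are counted but are not themselves nodes of $\omega$. The BGW trees at time $n$ are those with $\mathbb P^{GW}(\omega)>0$. The support of $\mu^{GW}$ is the set of $\chi$ with $\mu^{GW}(\chi)>0$. A tree $\omega$ gives a configuration $\chi(\omega)$ by setting $X_i=X_i(\omega)$ for $i\in\omega$ and $X_i=-1$ for all "phantom" sites $i\in\Lambda_n\setminus\omega$. *)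

theory Defs
  imports "HOL-Probability.Probability"
begin

text \<open>A Neveu label is the list of its digits, the root being the empty list.\<close>

definition sites :: "nat \<Rightarrow> nat list set" where
  "sites n = (\<Union>m\<in>{..n}. {i. length i = m \<and> set i \<subseteq> {1..}})"

definition parent :: "nat list \<Rightarrow> nat list" where
  "parent i = butlast i"

definition site_rank :: "nat list \<Rightarrow> nat" where
  "site_rank i = (if i = [] then 1 else last i)"

definition configurations :: "nat \<Rightarrow> (nat list \<Rightarrow> int) set" where
  "configurations n = (\<Pi>\<^sub>E i\<in>sites n. insert (-1) \<nat>)"

text \<open>The value at the parent of a site; \<open>b\<close> is the boundary value at the virtual
  ancestor of the root.\<close>

definition parent_value :: "nat \<Rightarrow> (nat list \<Rightarrow> int) \<Rightarrow> nat list \<Rightarrow> int" where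
  "parent_value b X i = (if i = [] then int b else X (parent i))"

text \<open>The offspring law with the convention that the weight of \<open>-1\<close> is \<open>1\<close>. Values below
  \<open>-1\<close> do not occur in configurations.\<close>

definition ext_law :: "nat pmf \<Rightarrow> int \<Rightarrow> real" where
  "ext_law p x = (if x < 0 then 1 else pmf p (nat x))"

definition site_weight :: "nat pmf \<Rightarrow> nat \<Rightarrow> (nat list \<Rightarrow> int) \<Rightarrow> nat list \<Rightarrow> real" where
  "site_weight p b X i = ext_law p (X i) *
     (of_bool (parent_value b X i \<ge> int (site_rank i)) * of_bool (X i \<ge> 0)
    + of_bool (parent_value b X i < int (site_rank i)) * of_bool (X i < 0))"

text \<open>The product over a possibly infinite index set, as the limit of the net of finite partial
  products. For factors in the unit interval this limit always exists, see
  \<open>infinite_prod_tendsto\<close> below; it may be \<open>0\<close>.\<close>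

definition infinite_prod :: "('i \<Rightarrow> real) \<Rightarrow> 'i set \<Rightarrow> real" where
  "infinite_prod f A = Lim (finite_subsets_at_top A) (\<lambda>F. \<Prod>i\<in>F. f i)"

definition mu_GW :: "nat pmf \<Rightarrow> nat \<Rightarrow> nat \<Rightarrow> (nat list \<Rightarrow> int) \<Rightarrow> real" where
  "mu_GW p b n X = infinite_prod (site_weight p b X) (sites n)"

definition mu_GW_support :: "nat pmf \<Rightarrow> nat \<Rightarrow> nat \<Rightarrow> (nat list \<Rightarrow> int) set" where
  "mu_GW_support p b n = {X \<in> configurations n. mu_GW p b n X > 0}"

text \<open>A tree is the partial map sending each of its nodes to the number of offspring of that
  node. Its set of nodes is the domain of the map, so the offspring of the nodes at distance
  \<open>n\<close> from the root are counted without being nodes themselves.\<close>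

definition trees :: "nat \<Rightarrow> (nat list \<rightharpoonup> nat) set" where
  "trees n = {\<omega>. dom \<omega> \<subseteq> sites n \<and> [] \<in> dom \<omega> \<and>
     (\<forall>i\<in>dom \<omega>. i \<noteq> [] \<longrightarrow> parent i \<in> dom \<omega>) \<and>
     (\<forall>i\<in>dom \<omega>. length i < n \<longrightarrow>
        {j \<in> dom \<omega>. j \<noteq> [] \<and> parent j = i} = (\<lambda>k. i @ [k]) ` {1..the (\<omega> i)})}"

text \<open>The set of nodes is always finite, see \<open>finite_tree\<close> below.\<close>

definition P_GW :: "nat pmf \<Rightarrow> (nat list \<rightharpoonup> nat) \<Rightarrow> real" where
  "P_GW p \<omega> = (\<Prod>i\<in>dom \<omega>. pmf p (the (\<omega> i)))"

definition BGW_trees :: "nat pmf \<Rightarrow> nat \<Rightarrow> (nat list \<rightharpoonup> nat) set" where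
  "BGW_trees p n = {\<omega> \<in> trees n. P_GW p \<omega> > 0}"

definition config_of_tree :: "nat \<Rightarrow> (nat list \<rightharpoonup> nat) \<Rightarrow> nat list \<Rightarrow> int" where
  "config_of_tree n \<omega> =
     (\<lambda>i\<in>sites n. if i \<in> dom \<omega> then int (the (\<omega> i)) else -1)"

definition tree_of_config :: "nat \<Rightarrow> (nat list \<Rightarrow> int) \<Rightarrow> (nat list \<rightharpoonup> nat)" where
  "tree_of_config n X = (\<lambda>i. if i \<in> sites n \<and> X i \<ge> 0 then Some (nat (X i)) else None)"

lemma infinite_prod_tendsto:
  fixes f :: "'i \<Rightarrow> real"
  assumes "\<And>i. i \<in> A \<Longrightarrow> 0 \<le> f i \<and> f i \<le> 1"
  shows "((\<lambda>F. \<Prod>i\<in>F. f i) \<longlongrightarrow> infinite_prod f A) (finite_subsets_at_top A)"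
proof -
  let ?S = "{F. finite F \<and> F \<subseteq> A}"
  let ?P = "\<lambda>F. \<Prod>i\<in>F. f i"
  let ?L = "INF F\<in>?S. ?P F"
  have ne: "?S \<noteq> {}" by blast
  have nonneg: "0 \<le> ?P F" if "F \<in> ?S" for F
    using that assms by (intro prod_nonneg) auto
  have bdd: "bdd_below (?P ` ?S)"
    using nonneg by (intro bdd_belowI[of _ 0]) auto
  have "(?P \<longlongrightarrow> ?L) (finite_subsets_at_top A)"
  proof (rule decreasing_tendsto)
    show "\<forall>\<^sub>F F in finite_subsets_at_top A. ?L \<le> ?P F"
      by (rule eventually_finite_subsets_at_top_weakI) (auto intro: cINF_lower[OF bdd])
  next
    fix x assume "?L < x"
    then obtain F where F: "F \<in> ?S" "?P F < x"
      using cINF_less_iff[OF ne bdd] by blast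
    have "?P G \<le> ?P F" if "finite G" "F \<subseteq> G" "G \<subseteq> A" for G
    proof -
      have "?P G = ?P F * ?P (G - F)"
        using that by (simp add: prod.subset_diff mult.commute)
      also have "\<dots> \<le> ?P F * 1"
        using that F assms nonneg by (intro mult_left_mono prod_le_1) auto
      finally show ?thesis by simp
    qed
    then show "\<forall>\<^sub>F F in finite_subsets_at_top A. ?P F < x"
      unfolding eventually_finite_subsets_at_top using F by (intro exI[of _ F]) force
  qed
  then show ?thesis
    unfolding infinite_prod_def by (simp add: tendsto_Lim)
qed

lemma finite_tree:
  assumes "\<omega> \<in> trees n"
  shows "finite (dom \<omega>)"
proof -
  have sub: "dom \<omega> \<subseteq> sites n"
    and par: "\<And>i. i \<in> dom \<omega> \<Longrightarrow> i \<noteq> [] \<Longrightarrow> parent i \<in> dom \<omega>"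
    and chl: "\<And>i. i \<in> dom \<omega> \<Longrightarrow> length i < n \<Longrightarrow>
        {j \<in> dom \<omega>. j \<noteq> [] \<and> parent j = i} = (\<lambda>k. i @ [k]) ` {1..the (\<omega> i)}"
    using assms by (auto simp: trees_def)
  have len: "length i \<le> n" if "i \<in> dom \<omega>" for i
    using that sub by (auto simp: sites_def)
  have level: "finite {i \<in> dom \<omega>. length i = m}" for m
  proof (induction m)
    case 0
    have "{i \<in> dom \<omega>. length i = 0} \<subseteq> {[]}" by auto
    then show ?case by (rule finite_subset) simp
  next
    case (Suc m)
    have "{i \<in> dom \<omega>. length i = Suc m} \<subseteq>
        (\<Union>i\<in>{i \<in> dom \<omega>. length i = m}. (\<lambda>k. i @ [k]) ` {1..the (\<omega> i)})"
    proof
      fix j assume "j \<in> {i \<in> dom \<omega>. length i = Suc m}"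
      then have j: "j \<in> dom \<omega>" "length j = Suc m" by auto
      then have "j \<noteq> []" by auto
      then have p: "parent j \<in> dom \<omega>" "length (parent j) = m"
        using par j by (auto simp: parent_def)
      moreover have "m < n" using len[OF j(1)] j(2) by simp
      ultimately have "j \<in> (\<lambda>k. parent j @ [k]) ` {1..the (\<omega> (parent j))}"
        using chl[of "parent j"] j(1) \<open>j \<noteq> []\<close> by blast
      with p show "j \<in> (\<Union>i\<in>{i \<in> dom \<omega>. length i = m}. (\<lambda>k. i @ [k]) ` {1..the (\<omega> i)})"
        by blast
    qed
    then show ?case using Suc.IH by (rule finite_subset[OF _ finite_UN_I]) auto
  qed
  have "dom \<omega> \<subseteq> (\<Union>m\<in>{..n}. {i \<in> dom \<omega>. length i = m})" using len by auto
  then show ?thesis by (rule finite_subset) (use level in auto)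
qed

end

theory Submission
  imports Defs
begin

text \<open>Since all factors lie in the unit interval, a positive product forces every factor to be
  positive. A positive factor at \<open>i\<close> means that \<open>X i \<ge> 0\<close> exactly when the rank of \<open>i\<close> is at
  most the value at the parent of \<open>i\<close>, which is the defining property of the nodes of a tree. For
  such a configuration the phantom sites contribute the factor \<open>1\<close> and the nodes form a finite set,
  so the infinite product is the finite product over the nodes.\<close>

text \<open>The part of membership in the support that does not involve \<open>p\<close>; what
  remains is positivity of a product over finitely many nodes.\<close>

definition tree_like :: "nat \<Rightarrow> nat \<Rightarrow> (nat list \<Rightarrow> int) \<Rightarrow> bool" where
  "tree_like b n X \<longleftrightarrow>
     (\<forall>i\<in>sites n. X i \<ge> 0 \<longleftrightarrow> parent_value b X i \<ge> int (site_rank i))"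

lemma tree_likeD:
  assumes "tree_like b n X" "i \<in> sites n"
  shows "X i \<ge> 0 \<longleftrightarrow> parent_value b X i \<ge> int (site_rank i)"
  using assms unfolding tree_like_def by blast

text \<open>Once a finite partial product includes \<open>a\<close>, its other factors only shrink
  it below \<open>f a\<close>, and the bound passes to the limit.\<close>

lemma infinite_prod_le_factor:
  fixes f :: "'i \<Rightarrow> real"
  assumes "\<And>i. i \<in> A \<Longrightarrow> 0 \<le> f i \<and> f i \<le> 1" and "a \<in> A"
  shows "infinite_prod f A \<le> f a"
proof (rule tendsto_upperbound[OF infinite_prod_tendsto])
  have "(\<Prod>i\<in>F. f i) \<le> f a" if "finite F" "{a} \<subseteq> F" "F \<subseteq> A" for F
  proof -
    have "(\<Prod>i\<in>F. f i) = f a * (\<Prod>i\<in>F - {a}. f i)"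
      using that by (intro prod.remove) auto
    also have "\<dots> \<le> f a * 1"
      using that assms by (intro mult_left_mono prod_le_1) auto
    finally show ?thesis by simp
  qed
  then show "\<forall>\<^sub>F F in finite_subsets_at_top A. (\<Prod>i\<in>F. f i) \<le> f a"
    unfolding eventually_finite_subsets_at_top using assms(2) by (intro exI[of _ "{a}"]) auto
qed (use assms in auto)

text \<open>The net of partial products is constant from \<open>D\<close> onwards.\<close>

lemma infinite_prod_eq_prod:
  fixes f :: "'i \<Rightarrow> real"
  assumes "finite D" "D \<subseteq> A" "\<And>i. i \<in> A - D \<Longrightarrow> f i = 1"
  shows "infinite_prod f A = (\<Prod>i\<in>D. f i)"
proof -
  have "(\<Prod>i\<in>F. f i) = (\<Prod>i\<in>D. f i)" if "finite F" "D \<subseteq> F" "F \<subseteq> A" for F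
    using that assms(3) by (intro prod.mono_neutral_right) blast+
  then have "\<forall>\<^sub>F F in finite_subsets_at_top A. (\<Prod>i\<in>F. f i) = (\<Prod>i\<in>D. f i)"
    unfolding eventually_finite_subsets_at_top using assms(1,2) by blast
  then show ?thesis
    unfolding infinite_prod_def by (intro tendsto_Lim tendsto_eventually) auto
qed

lemma sites_iff: "i \<in> sites n \<longleftrightarrow> length i \<le> n \<and> (\<forall>k\<in>set i. 1 \<le> k)"
  by (auto simp: sites_def)

lemma snoc_in_sites: "i @ [k] \<in> sites n \<longleftrightarrow> i \<in> sites n \<and> length i < n \<and> 1 \<le> k"
  by (auto simp: sites_iff)

lemma site_weight_bounds: "0 \<le> site_weight p b X i \<and> site_weight p b X i \<le> 1"
  by (auto simp: site_weight_def ext_law_def pmf_le_1 of_bool_def)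

lemma site_weight_pos_iff:
  "site_weight p b X i > 0 \<longleftrightarrow>
     (X i \<ge> 0 \<longleftrightarrow> parent_value b X i \<ge> int (site_rank i)) \<and> ext_law p (X i) > 0"
  by (auto simp: site_weight_def of_bool_def)

lemma site_weight_tree_like:
  assumes "tree_like b n X" "i \<in> sites n"
  shows "site_weight p b X i = ext_law p (X i)"
  using tree_likeD[OF assms] by (auto simp: site_weight_def of_bool_def)

lemma tree_like_if_mu_GW_pos:
  assumes "mu_GW p b n X > 0"
  shows "tree_like b n X"
proof -
  have "site_weight p b X i > 0" if "i \<in> sites n" for i
    using assms infinite_prod_le_factor[of "sites n" "site_weight p b X" i,
        OF site_weight_bounds that]
    by (simp add: mu_GW_def)
  then show ?thesis
    by (simp add: tree_like_def site_weight_pos_iff)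
qed

lemma dom_tree_of_config: "dom (tree_of_config n X) = {i \<in> sites n. X i \<ge> 0}"
  by (auto simp: tree_of_config_def dom_def)

lemma tree_of_config_in_trees:
  assumes X: "tree_like b n X" and b: "b \<ge> 1"
  shows "tree_of_config n X \<in> trees n"
proof -
  have snoc: "X (i @ [k]) \<ge> 0 \<longleftrightarrow> X i \<ge> int k" if "i @ [k] \<in> sites n" for i k
    using tree_likeD[OF X that] by (simp add: parent_value_def parent_def site_rank_def)
  \<comment> \<open>The root has rank 1 and the virtual ancestor has value \<open>b \<ge> 1\<close>,
    so the root is never a phantom site.\<close>
  have root: "[] \<in> sites n" "X [] \<ge> 0"
    using tree_likeD[OF X, of "[]"] b
    by (simp_all add: parent_value_def site_rank_def sites_iff)
  \<comment> \<open>Digits are at least 1, so a node \<open>i @ [k]\<close> forces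
    \<open>X i \<ge> k \<ge> 1\<close>: phantom sites have no children.\<close>
  have par: "parent i \<in> sites n \<and> X (parent i) \<ge> 0"
    if "i \<in> sites n" "X i \<ge> 0" "i \<noteq> []" for i
    using that snoc by (cases i rule: rev_cases) (auto simp: parent_def snoc_in_sites)
  have children: "{j \<in> sites n. X j \<ge> 0 \<and> j \<noteq> [] \<and> parent j = i}
      = (\<lambda>k. i @ [k]) ` {1..the (tree_of_config n X i)}"
    if i: "i \<in> sites n" "X i \<ge> 0" "length i < n" for i
  proof -
    \<comment> \<open>Because \<open>length i < n\<close>, every \<open>i @ [k]\<close> with
      \<open>k \<ge> 1\<close> is again a site, so all \<open>X i\<close> children occur.\<close>
    have "j \<in> sites n \<and> X j \<ge> 0 \<and> j \<noteq> [] \<and> parent j = i \<longleftrightarrow>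
        (\<exists>k. j = i @ [k] \<and> 1 \<le> k \<and> k \<le> nat (X i))" for j
      using i snoc
      by (cases j rule: rev_cases) (auto simp: parent_def snoc_in_sites le_nat_iff)
    then show ?thesis
      using i by (auto simp: tree_of_config_def image_iff)
  qed
  show ?thesis
    using root par children by (auto simp: trees_def dom_tree_of_config)
qed

text \<open>No positivity is assumed, so the equality carries positivity both from configurations to
  trees and back.\<close>

lemma mu_GW_tree_like:
  assumes "tree_like b n X" and "b \<ge> 1"
  shows "mu_GW p b n X = P_GW p (tree_of_config n X)"
proof -
  let ?D = "{i \<in> sites n. X i \<ge> 0}"
  \<comment> \<open>Offspring numbers may be unbounded over all trees, but each single tree is
    finite.\<close>
  have "finite ?D"
    using finite_tree[OF tree_of_config_in_trees[OF assms]] by (simp add: dom_tree_of_config)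
  then have "mu_GW p b n X = (\<Prod>i\<in>?D. site_weight p b X i)"
    unfolding mu_GW_def
    by (rule infinite_prod_eq_prod) (auto simp: site_weight_tree_like[OF assms(1)] ext_law_def)
  also have "\<dots> = P_GW p (tree_of_config n X)"
    unfolding P_GW_def dom_tree_of_config
    by (rule prod.cong)
      (auto simp: site_weight_tree_like[OF assms(1)] ext_law_def tree_of_config_def)
  finally show ?thesis .
qed

lemma config_of_tree_in_configurations: "config_of_tree n \<omega> \<in> configurations n"
  by (auto simp: config_of_tree_def configurations_def)

text \<open>For a site below the root, the claim is the child condition of trees if its parent is a
  node, and closure under parents otherwise.\<close>

lemma tree_like_config_of_tree:
  assumes \<omega>: "\<omega> \<in> trees n" and b: "b \<ge> 1"
  shows "tree_like b n (config_of_tree n \<omega>)"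
  unfolding tree_like_def
proof
  fix i assume i: "i \<in> sites n"
  show "config_of_tree n \<omega> i \<ge> 0 \<longleftrightarrow>
    parent_value b (config_of_tree n \<omega>) i \<ge> int (site_rank i)"
  proof (cases i rule: rev_cases)
    case Nil
    then show ?thesis
      using \<omega> b i by (auto simp: trees_def config_of_tree_def parent_value_def site_rank_def)
  next
    case (snoc j k)
    then have j: "j \<in> sites n" "length j < n" "1 \<le> k"
      using i by (auto simp: snoc_in_sites)
    show ?thesis
    proof (cases "j \<in> dom \<omega>")
      case True
      then have "{i \<in> dom \<omega>. i \<noteq> [] \<and> parent i = j} = (\<lambda>k. j @ [k]) ` {1..the (\<omega> j)}"
        using \<omega> j by (auto simp: trees_def)
      moreover have "i \<in> dom \<omega> \<longleftrightarrow> i \<in> {i \<in> dom \<omega>. i \<noteq> [] \<and> parent i = j}"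
        using snoc by (simp add: parent_def)
      ultimately have "i \<in> dom \<omega> \<longleftrightarrow> k \<le> the (\<omega> j)"
        using snoc j by auto
      then show ?thesis
        using True i j snoc
        by (auto simp: config_of_tree_def parent_value_def site_rank_def parent_def)
    next
      case False
      \<comment> \<open>Both sides of the equivalence fail: \<open>i\<close> is a phantom site, and
        its parent has value \<open>-1\<close>, below the rank \<open>k\<close>.\<close>
      then have "i \<notin> dom \<omega>"
        using \<omega> snoc by (auto simp: trees_def parent_def dest!: bspec[of _ _ i])
      then show ?thesis
        using False i j snoc
        by (auto simp: config_of_tree_def parent_value_def site_rank_def parent_def)
    qed
  qed
qed

text \<open>The tree forgets the values at phantom sites, but \<open>-1\<close> is the only negative
  value of a configuration; off \<open>sites n\<close> both functions are
  \<open>undefined\<close>.\<close>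

lemma config_of_tree_of_config:
  assumes "X \<in> configurations n"
  shows "config_of_tree n (tree_of_config n X) = X"
proof
  fix i
  show "config_of_tree n (tree_of_config n X) i = X i"
    using assms
    by (cases "i \<in> sites n")
      (auto simp: config_of_tree_def tree_of_config_def configurations_def PiE_iff
        extensional_def dom_def Nats_altdef1)
qed

lemma tree_of_config_of_tree:
  assumes "\<omega> \<in> trees n"
  shows "tree_of_config n (config_of_tree n \<omega>) = \<omega>"
proof
  fix i
  have "dom \<omega> \<subseteq> sites n"
    using assms by (simp add: trees_def)
  then show "tree_of_config n (config_of_tree n \<omega>) i = \<omega> i"
    by (cases "\<omega> i") (auto simp: config_of_tree_def tree_of_config_def)
qed

theorem proposition2:
  fixes p :: "nat pmf" and n b :: nat
  assumes "pmf p 0 > 0"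
    and "pmf p 0 + pmf p 1 < 1"
    and "n \<ge> 1"
    and "b \<ge> 1"
  shows "bij_betw (tree_of_config n) (mu_GW_support p b n) (BGW_trees p n) \<and>
         bij_betw (config_of_tree n) (BGW_trees p n) (mu_GW_support p b n) \<and>
         (\<forall>X\<in>mu_GW_support p b n. config_of_tree n (tree_of_config n X) = X) \<and>
         (\<forall>\<omega>\<in>BGW_trees p n. tree_of_config n (config_of_tree n \<omega>) = \<omega>) \<and>
         (\<forall>X\<in>mu_GW_support p b n. P_GW p (tree_of_config n X) = mu_GW p b n X) \<and>
         (\<forall>\<omega>\<in>BGW_trees p n. mu_GW p b n (config_of_tree n \<omega>) = P_GW p \<omega>)"
proof -
  let ?S = "mu_GW_support p b n" and ?T = "BGW_trees p n"
  have S: "X \<in> configurations n" "tree_like b n X" "mu_GW p b n X > 0" if "X \<in> ?S" for X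
    using that tree_like_if_mu_GW_pos by (auto simp: mu_GW_support_def)
  have T: "\<omega> \<in> trees n" "P_GW p \<omega> > 0" if "\<omega> \<in> ?T" for \<omega>
    using that by (auto simp: BGW_trees_def)
  have CT: "\<forall>X\<in>?S. config_of_tree n (tree_of_config n X) = X"
    using S config_of_tree_of_config by blast
  have TC: "\<forall>\<omega>\<in>?T. tree_of_config n (config_of_tree n \<omega>) = \<omega>"
    using T tree_of_config_of_tree by blast
  have PS: "\<forall>X\<in>?S. P_GW p (tree_of_config n X) = mu_GW p b n X"
    using S mu_GW_tree_like[OF _ \<open>b \<ge> 1\<close>] by simp
  \<comment> \<open>The product formula yields the weight of the tree rebuilt from the
    configuration, which \<open>TC\<close> identifies with \<open>\<omega>\<close>.\<close>
  have PT: "\<forall>\<omega>\<in>?T. mu_GW p b n (config_of_tree n \<omega>) = P_GW p \<omega>"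
    using T TC mu_GW_tree_like[OF tree_like_config_of_tree[OF _ \<open>b \<ge> 1\<close>] \<open>b \<ge> 1\<close>] by simp
  have ST: "tree_of_config n ` ?S \<subseteq> ?T"
    using S PS tree_of_config_in_trees[OF _ \<open>b \<ge> 1\<close>] by (auto simp: BGW_trees_def)
  have TS: "config_of_tree n ` ?T \<subseteq> ?S"
    using T PT config_of_tree_in_configurations by (auto simp: mu_GW_support_def)
  show ?thesis
    \<comment> \<open>The same four facts, with the roles of the two mutually inverse maps
      exchanged, give both bijections.\<close>
    using bij_betw_byWitness[OF CT TC ST TS] bij_betw_byWitness[OF TC CT TS ST] CT TC PS PT
    by blast
qed

end
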